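(* Let $K$ be a global field, let $V$ be a projective variety over $K$, and let $S$ be a height controlled and uniformly log-discrete set of endomorphisms of $V$ with respect to a divisor class $\eta\in\mathrm{Pic}(V)\otimes\mathbb{R}$. Then the following statements hold. (1) There are a positive constant $b=b(S,\eta)$ and a constant $B_{S,\eta}$ such that $$\#\{Q\in \mathrm{Orb}_{S}(P) : H_\eta(Q)\leq B\}\ll (\log B)^{b}$$ for all $P\in V$ with $H_\eta(P)>B_{S,\eta}$. (2) If the monoid $M_S$ is free (non-abelian), then for all $\epsilon>0$ there are a positive constant $b=b(S,\eta,\epsilon)$ and a constant $B_{S,\eta}$ such that $$(\log B)^{b}\ll\#\{f\in M_S : H_\eta(f(P))\leq B\}\ll (\log B)^{b+\epsilon}$$ for all $P\in V$ with $H_\eta(P)>B_{S,\eta}$. In both statements the implicit constants depend on $P$, $S$, $\eta$ (and on $\epsilon$ in statement (2)).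
   Context: Points of $V$ are points of $V(\overline{K})$. For $\eta\in\mathrm{Pic}(V)\otimes\mathbb{R}$, $h_\eta:V(\overline{K})\to\mathbb{R}$ denotes a fixed choice of (absolute logarithmic) Weil height function associated to $\eta$ (well defined up to $O(1)$), and $H_\eta=\exp\circ h_\eta$. If $\phi$ is an endomorphism of $V$ and $d_\phi\in\mathbb{R}$ satisfies $\phi^*(\eta)=d_\phi\eta$ in $\mathrm{Pic}(V)\otimes\mathbb{R}$, then $C(V,\eta,\phi)$ denotes the minimal constant such that $|h_\eta(\phi(P))-d_\phi h_\eta(P)|\leq C(V,\eta,\phi)$ for all $P\in V$. A (possibly infinite) set $S$ of endomorphisms of $V$ is height controlled with respect to $\eta$ if: (i) for every $\phi\in S$ there is a real number $d_\phi>1$ with $\phi^*(\eta)=d_\phi\eta$; and (ii) $\sup_{\phi\in S}C(V,\eta,\phi)<\infty$. It is height controlled and uniformly log-discrete with respect to $\eta$ if, in addition, there is a constant $\delta>0$ such that $|\log d_\phi-\log d_\psi|>\delta$ for all distinct $\phi,\psi\in S$. $M_S$ is the monoid generated by $S$ under composition (including the identity map), and $\mathrm{Orb}_S(P)=\{f(P): f\in M_S\}$. "$M_S$ is free (non-abelian)" means that $S$ has at least two elements and $M_S$ is a free monoid on the generating set $S$, i.e. $\theta_1\circ\cdots\circ\theta_r=\tau_1\circ\cdots\circ\tau_k$ with $\theta_i,\tau_j\in S$ implies $r=k$ and $\theta_i=\tau_i$ for all $i$. The notation $F(B)\ll G(B)$ means that there are a constant $c>0$ and a $B_0$ such that $F(B)\le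 c\,G(B)$ for all $B\ge B_0$; both $c$ and $B_0$ may depend on the indicated data. *)

theory Defs
  imports
    "HOL-Analysis.Analysis"
    "HOL-Library.Poly_Mapping"
    "HOL-Algebra.Algebraic_Closure_Type"
    "HOL-Algebra.Generated_Fields"
begin

section \<open>Global fields\<close>

text \<open>A global field is a finite extension of \<open>\<rat>\<close> or of some \<open>\<F>\<^sub>p(t)\<close> with \<open>t\<close> transcendental
  over \<open>\<F>\<^sub>p\<close>.  The field \<open>generate_field R {}\<close> is the prime field of \<open>R\<close>.\<close>

definition global_field :: "'k :: field itself \<Rightarrow> bool" where
  "global_field _ \<longleftrightarrow>
    (let R = (ring_of_type_algebra :: 'k ring) in
      if CHAR('k) = 0
      then ring.finite_dimension R (generate_field R {}) UNIV
      else \<exists>t. ring.transcendental R (generate_field R {}) t \<and>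
               ring.finite_dimension R (generate_field R {t}) UNIV)"


section \<open>Projective varieties over a field\<close>

text \<open>The base field \<open>K\<close> is the type \<open>'k\<close>, and \<open>'k alg_closure\<close> is its algebraic closure.
  A point of projective space is the set of all its vectors of homogeneous coordinates; a vector of
  coordinates in \<open>P\<^sup>n\<close> is a function on \<open>nat\<close> that vanishes beyond \<open>n\<close>.\<close>

type_synonym 'k point = "(nat \<Rightarrow> 'k alg_closure) set"
type_synonym 'k poly_form = "(nat \<Rightarrow>\<^sub>0 nat) \<Rightarrow>\<^sub>0 'k"

definition proj_space :: "nat \<Rightarrow> 'k :: field point set" where
  "proj_space n =
    {{\<lambda>i. c * x i | c. c \<noteq> 0} | x. (\<exists>i. x i \<noteq> 0) \<and> (\<forall>i>n. x i = 0)}"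

text \<open>Polynomials have coefficients in \<open>K\<close>.  Variables with index greater than \<open>n\<close>
  are allowed, but they vanish on \<open>proj_space n\<close>.\<close>

definition homogeneous :: "nat \<Rightarrow> 'k :: field poly_form \<Rightarrow> bool" where
  "homogeneous d F \<longleftrightarrow>
    (\<forall>m\<in>Poly_Mapping.keys F. (\<Sum>i\<in>Poly_Mapping.keys m. Poly_Mapping.lookup m i) = d)"

definition eval_form :: "'k :: field poly_form \<Rightarrow> (nat \<Rightarrow> 'k alg_closure) \<Rightarrow> 'k alg_closure" where
  "eval_form F x =
    (\<Sum>m\<in>Poly_Mapping.keys F. to_ac (Poly_Mapping.lookup F m) *
      (\<Prod>i\<in>Poly_Mapping.keys m. x i ^ Poly_Mapping.lookup m i))"

text \<open>The topology is the Zariski topology of \<open>K\<close>: closed sets are cut out by homogeneous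
  polynomials with coefficients in \<open>K\<close>.\<close>

definition zariski_closed_in :: "'k :: field point set \<Rightarrow> 'k point set \<Rightarrow> bool" where
  "zariski_closed_in V Z \<longleftrightarrow>
    (\<exists>T. (\<forall>F\<in>T. \<exists>d. homogeneous d F) \<and>
         Z = {P\<in>V. \<forall>F\<in>T. \<forall>x\<in>P. eval_form F x = 0})"

definition zariski_open_in :: "'k :: field point set \<Rightarrow> 'k point set \<Rightarrow> bool" where
  "zariski_open_in V U \<longleftrightarrow> U \<subseteq> V \<and> zariski_closed_in V (V - U)"

text \<open>Irreducibility is required over \<open>K\<close> only, so that these are the integral closed subschemes
  of \<open>P\<^sup>n\<close> over \<open>K\<close>, represented by their points over the algebraic closure.\<close>

definition projective_variety :: "'k :: field point set \<Rightarrow> bool" where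
  "projective_variety V \<longleftrightarrow>
    (\<exists>n. zariski_closed_in (proj_space n) V) \<and> V \<noteq> {} \<and>
    (\<forall>Z Z'. zariski_closed_in V Z \<and> zariski_closed_in V Z' \<and> V = Z \<union> Z' \<longrightarrow> V = Z \<or> V = Z')"

definition regular_on ::
    "'k :: field point set \<Rightarrow> 'k point set \<Rightarrow> ('k point \<Rightarrow> 'k alg_closure) \<Rightarrow> bool" where
  "regular_on V U f \<longleftrightarrow>
    (\<forall>P\<in>U. \<exists>W d F G. zariski_open_in V W \<and> P \<in> W \<and> W \<subseteq> U \<and>
       homogeneous d F \<and> homogeneous d G \<and>
       (\<forall>Q\<in>W. \<forall>x\<in>Q. eval_form G x \<noteq> 0 \<and> f Q = eval_form F x / eval_form G x))"

text \<open>A morphism (over \<open>K\<close>) is locally given by tuples of homogeneous polynomials of equal degree.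
  Membership in \<open>\<phi> Q\<close> entails that the tuple does not vanish.  Morphisms are extensional, so that
  equality of functions is equality of morphisms.\<close>

definition morphism ::
    "'k :: field point set \<Rightarrow> 'k point set \<Rightarrow> ('k point \<Rightarrow> 'k point) \<Rightarrow> bool" where
  "morphism V W \<phi> \<longleftrightarrow> \<phi> \<in> V \<rightarrow>\<^sub>E W \<and>
    (\<forall>P\<in>V. \<exists>U d F. zariski_open_in V U \<and> P \<in> U \<and> (\<forall>i. homogeneous d (F i)) \<and>
       (\<forall>Q\<in>U. \<forall>x\<in>Q. (\<lambda>i. eval_form (F i) x) \<in> \<phi> Q))"


section \<open>The Picard group\<close>

text \<open>A line bundle is given by a trivialization on an open neighbourhood \<open>nbhd L P\<close> of every
  point \<open>P\<close> and by transition functions: if \<open>s\<^sub>P\<close> denotes a section \<open>s\<close> in the trivialization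
  at \<open>P\<close>, then \<open>s\<^sub>P = transition L P Q \<cdot> s\<^sub>Q\<close> on \<open>nbhd L P \<inter> nbhd L Q\<close>.\<close>

record (overloaded) ('k :: field) line_bundle =
  nbhd :: "'k point \<Rightarrow> 'k point set"
  transition :: "'k point \<Rightarrow> 'k point \<Rightarrow> 'k point \<Rightarrow> 'k alg_closure"

definition line_bundles :: "'k :: field point set \<Rightarrow> 'k line_bundle set" where
  "line_bundles V = {L.
    (\<forall>P\<in>V. zariski_open_in V (nbhd L P) \<and> P \<in> nbhd L P) \<and>
    (\<forall>P\<in>V. \<forall>Q\<in>V. regular_on V (nbhd L P \<inter> nbhd L Q) (transition L P Q)) \<and>
    (\<forall>P\<in>V. \<forall>R\<in>nbhd L P. transition L P P R = 1) \<and>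
    (\<forall>P\<in>V. \<forall>Q\<in>V. \<forall>T\<in>V. \<forall>R\<in>nbhd L P \<inter> nbhd L Q \<inter> nbhd L T.
       transition L P Q R * transition L Q T R = transition L P T R)}"

text \<open>An isomorphism between \<open>L\<close> and \<open>M\<close> is given by invertible regular functions \<open>u P Q\<close> that
  describe it in the trivialization of \<open>L\<close> at \<open>P\<close> and that of \<open>M\<close> at \<open>Q\<close>.\<close>

definition lb_iso :: "'k :: field point set \<Rightarrow> ('k line_bundle \<times> 'k line_bundle) set" where
  "lb_iso V = {(L, M). L \<in> line_bundles V \<and> M \<in> line_bundles V \<and>
    (\<exists>u. (\<forall>P\<in>V. \<forall>Q\<in>V. regular_on V (nbhd L P \<inter> nbhd M Q) (u P Q) \<and>
                        (\<forall>R\<in>nbhd L P \<inter> nbhd M Q. u P Q R \<noteq> 0)) \<and>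
         (\<forall>P\<in>V. \<forall>P'\<in>V. \<forall>Q\<in>V. \<forall>Q'\<in>V.
            \<forall>R\<in>nbhd L P \<inter> nbhd L P' \<inter> nbhd M Q \<inter> nbhd M Q'.
              u P Q R * transition M Q Q' R = transition L P P' R * u P' Q' R))}"

definition lb_class :: "'k :: field point set \<Rightarrow> 'k line_bundle \<Rightarrow> 'k line_bundle set" where
  "lb_class V L = lb_iso V `` {L}"

definition lb_trivial :: "'k :: field point set \<Rightarrow> 'k line_bundle" where
  "lb_trivial V = \<lparr>nbhd = (\<lambda>P. V), transition = (\<lambda>P Q R. 1)\<rparr>"

definition lb_tensor :: "'k :: field line_bundle \<Rightarrow> 'k line_bundle \<Rightarrow> 'k line_bundle" where
  "lb_tensor L M =
    \<lparr>nbhd = (\<lambda>P. nbhd L P \<inter> nbhd M P), transition = (\<lambda>P Q R. transition L P Q R * transition M P Q R)\<rparr>"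

definition lb_pullback ::
    "'k :: field point set \<Rightarrow> ('k point \<Rightarrow> 'k point) \<Rightarrow> 'k line_bundle \<Rightarrow> 'k line_bundle" where
  "lb_pullback V \<phi> L =
    \<lparr>nbhd = (\<lambda>P. {Q\<in>V. \<phi> Q \<in> nbhd L (\<phi> P)}),
     transition = (\<lambda>P Q R. transition L (\<phi> P) (\<phi> Q) (\<phi> R))\<rparr>"

text \<open>\<open>O(1)\<close> on \<open>P\<^sup>n\<close>.  The neighbourhood of \<open>P\<close> is \<open>{x\<^sub>i \<noteq> 0}\<close> for the first
  nonzero coordinate \<open>x\<^sub>i\<close> of \<open>P\<close>, where the section \<open>x\<^sub>k\<close> becomes \<open>x\<^sub>k / x\<^sub>i\<close>; thus the
  transition function from \<open>{x\<^sub>j \<noteq> 0}\<close> to \<open>{x\<^sub>i \<noteq> 0}\<close> is \<open>x\<^sub>j / x\<^sub>i\<close>.\<close>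

definition coords :: "'k :: field point \<Rightarrow> nat \<Rightarrow> 'k alg_closure" where
  "coords P = (SOME x. x \<in> P)"

definition first_coord :: "'k :: field point \<Rightarrow> nat" where
  "first_coord P = (LEAST i. coords P i \<noteq> 0)"

definition lb_O1 :: "nat \<Rightarrow> 'k :: field line_bundle" where
  "lb_O1 n =
    \<lparr>nbhd = (\<lambda>P. {Q\<in>proj_space n. coords Q (first_coord P) \<noteq> 0}),
     transition = (\<lambda>P Q R. coords R (first_coord Q) / coords R (first_coord P))\<rparr>"

definition Pic :: "'k :: field point set \<Rightarrow> 'k line_bundle set monoid" where
  "Pic V =
    \<lparr>carrier = line_bundles V // lb_iso V,
     monoid.mult = (\<lambda>a b. \<Union>L\<in>a. \<Union>M\<in>b. lb_class V (lb_tensor L M)),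
     one = lb_class V (lb_trivial V)\<rparr>"

definition Pic_pullback ::
    "'k :: field point set \<Rightarrow> ('k point \<Rightarrow> 'k point) \<Rightarrow> 'k line_bundle set \<Rightarrow> 'k line_bundle set" where
  "Pic_pullback V \<phi> a = (\<Union>L\<in>a. lb_class V (lb_pullback V \<phi> L))"


section \<open>Tensoring an abelian group with the reals\<close>

instantiation poly_mapping :: (type, real_vector) real_vector
begin

lift_definition scaleR_poly_mapping :: "real \<Rightarrow> ('a \<Rightarrow>\<^sub>0 'b) \<Rightarrow> 'a \<Rightarrow>\<^sub>0 'b"
  is "\<lambda>r f x. r *\<^sub>R f x"
  by (rule finite_subset[rotated]) auto

instance
  by standard (transfer; simp add: scaleR_add_right scaleR_add_left fun_eq_iff)+

end

text \<open>\<open>G \<otimes> \<real>\<close> is the free real vector space on \<open>G\<close> modulo the span of all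
  \<open>[x \<cdot> y] - [x] - [y]\<close>.\<close>

definition free_real :: "('g, 'm) monoid_scheme \<Rightarrow> ('g \<Rightarrow>\<^sub>0 real) set" where
  "free_real G = {f. Poly_Mapping.keys f \<subseteq> carrier G}"

definition tensor_real_rel :: "('g, 'm) monoid_scheme \<Rightarrow> (('g \<Rightarrow>\<^sub>0 real) \<times> ('g \<Rightarrow>\<^sub>0 real)) set" where
  "tensor_real_rel G = {(f, g). f \<in> free_real G \<and> g \<in> free_real G \<and>
    f - g \<in> real_vector.span
      {Poly_Mapping.single (x \<otimes>\<^bsub>G\<^esub> y) 1 - Poly_Mapping.single x 1 - Poly_Mapping.single y 1
        | x y. x \<in> carrier G \<and> y \<in> carrier G}}"

definition tensor_real :: "('g, 'm) monoid_scheme \<Rightarrow> ('g \<Rightarrow>\<^sub>0 real) set set" where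
  "tensor_real G = free_real G // tensor_real_rel G"

definition tensor_scale ::
    "('g, 'm) monoid_scheme \<Rightarrow> real \<Rightarrow> ('g \<Rightarrow>\<^sub>0 real) set \<Rightarrow> ('g \<Rightarrow>\<^sub>0 real) set" where
  "tensor_scale G r \<eta> = (\<Union>f\<in>\<eta>. tensor_real_rel G `` {r *\<^sub>R f})"

text \<open>The linear map on \<open>_ \<otimes> \<real>\<close>, with values in \<open>G \<otimes> \<real>\<close>, induced by the homomorphism \<open>a\<close>.\<close>

definition tensor_map ::
    "('g, 'm) monoid_scheme \<Rightarrow> ('h \<Rightarrow> 'g) \<Rightarrow> ('h \<Rightarrow>\<^sub>0 real) set \<Rightarrow> ('g \<Rightarrow>\<^sub>0 real) set" where
  "tensor_map G a \<eta> =
    (\<Union>f\<in>\<eta>. tensor_real_rel G ``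
       {\<Sum>x\<in>Poly_Mapping.keys f. Poly_Mapping.single (a x) (Poly_Mapping.lookup f x)})"


section \<open>Heights\<close>

text \<open>The normalized absolute values of a global field \<open>L\<close> inside the algebraic closure:
  \<open>q\<^bsup>- ord x\<^esup>\<close> with \<open>q\<close> the cardinality of the residue field at the nonarchimedean places,
  and \<open>\<bar>\<sigma> x\<bar>\<close> or \<open>\<bar>\<sigma> x\<bar>\<^sup>2\<close> at the real and the complex places.  The complex embeddings
  \<open>\<sigma>\<close> and \<open>cnj \<circ> \<sigma>\<close> yield the same function, hence a single place.\<close>

definition residue_field ::
    "'k :: field alg_closure set \<Rightarrow> ('k alg_closure \<Rightarrow> real) \<Rightarrow> 'k alg_closure set set" where
  "residue_field L v =
    {x\<in>L. v x \<le> 1} // {(x, y). x \<in> L \<and> y \<in> L \<and> v x \<le> 1 \<and> v y \<le> 1 \<and> v (x - y) < 1}"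

definition nonarch_places :: "'k :: field alg_closure set \<Rightarrow> ('k alg_closure \<Rightarrow> real) set" where
  "nonarch_places L = {v \<in> extensional L.
    v 0 = 0 \<and>
    (\<forall>x\<in>L. \<forall>y\<in>L. v (x * y) = v x * v y) \<and>
    (\<forall>x\<in>L. \<forall>y\<in>L. v (x + y) \<le> max (v x) (v y)) \<and>
    finite (residue_field L v) \<and>
    v ` (L - {0}) = range (\<lambda>k :: int. real (card (residue_field L v)) powi k)}"

definition arch_places :: "'k :: field alg_closure set \<Rightarrow> ('k alg_closure \<Rightarrow> real) set" where
  "arch_places L =
    {restrict (\<lambda>x. cmod (\<sigma> x) ^ (if \<sigma> ` L \<subseteq> \<real> then 1 else 2)) L | \<sigma> :: 'k alg_closure \<Rightarrow> complex.
       \<sigma> 1 = 1 \<and> (\<forall>x\<in>L. \<forall>y\<in>L. \<sigma> (x + y) = \<sigma> x + \<sigma> y \<and> \<sigma> (x * y) = \<sigma> x * \<sigma> y)}"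

definition places :: "'k :: field alg_closure set \<Rightarrow> ('k alg_closure \<Rightarrow> real) set" where
  "places L = nonarch_places L \<union> arch_places L"

text \<open>The absolute logarithmic height \<open>h(x) = 1/[L : L\<^sub>0] \<cdot> (\<Sum>v. ln (max\<^sub>i \<bar>x\<^sub>i\<bar>\<^sub>v))\<close> is computed
  over the field \<open>L = K(x\<^sub>0, \<dots>, x\<^sub>n)\<close>; only finitely many summands are nonzero.  It is normalized
  with respect to \<open>L\<^sub>0 = \<rat>\<close> for number fields.  For function fields there is no
  canonical choice of a subfield \<open>\<F>\<^sub>p(t)\<close>, and \<open>L\<^sub>0 = K\<close>.\<close>

definition height_vec :: "(nat \<Rightarrow> 'k :: field alg_closure) \<Rightarrow> real" where
  "height_vec x =
    (let R = (ring_of_type_algebra :: 'k alg_closure ring);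
         L = generate_field R (range to_ac \<union> range x);
         L0 = (if CHAR('k) = 0 then generate_field R {} else range to_ac);
         lmax = (\<lambda>v. ln (Max (v ` range x)))
     in (\<Sum>v | v \<in> places L \<and> lmax v \<noteq> 0. lmax v) / real (ring.dim R L0 L))"

definition height :: "'k :: field point \<Rightarrow> real" where
  "height P = height_vec (coords P)"

text \<open>\<open>h\<close> is a Weil height function for \<open>\<eta>\<close>: the divisor class \<open>\<eta>\<close> is a real
  linear combination of pullbacks of \<open>O(1)\<close> under morphisms \<open>\<psi> i\<close> to projective spaces, and up to
  a bounded function \<open>h\<close> is the same combination of the heights of the \<open>\<psi> i P\<close>.
  Every class is such a combination, since \<open>Pic V\<close> is generated by very ample classes.\<close>

definition weil_height ::
    "'k :: field point set \<Rightarrow> ('k line_bundle set \<Rightarrow>\<^sub>0 real) set \<Rightarrow> ('k point \<Rightarrow> real) \<Rightarrow> bool" where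
  "weil_height V \<eta> h \<longleftrightarrow>
    (\<exists>(N :: nat) (r :: nat \<Rightarrow> real) (m :: nat \<Rightarrow> nat) (\<psi> :: nat \<Rightarrow> 'k point \<Rightarrow> 'k point) (C :: real).
       (\<forall>i<N. morphism V (proj_space (m i)) (\<psi> i)) \<and>
       \<eta> = tensor_real_rel (Pic V) ``
         {\<Sum>i<N. Poly_Mapping.single (lb_class V (lb_pullback V (\<psi> i) (lb_O1 (m i)))) (r i)} \<and>
       (\<forall>P\<in>V. \<bar>h P - (\<Sum>i<N. r i * height (\<psi> i P))\<bar> \<le> C))"


section \<open>Height controlled sets of endomorphisms\<close>

text \<open>The minimal constant \<open>C(V, \<eta>, \<phi>)\<close>, for the chosen height function \<open>h\<close> and \<open>d = d\<^sub>\<phi>\<close>.\<close>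

definition height_const ::
    "'k :: field point set \<Rightarrow> ('k point \<Rightarrow> real) \<Rightarrow> ('k point \<Rightarrow> 'k point) \<Rightarrow> real \<Rightarrow> ereal" where
  "height_const V h \<phi> d = Inf {C. \<forall>P\<in>V. ereal \<bar>h (\<phi> P) - d * h P\<bar> \<le> C}"

text \<open>The degrees \<open>d\<^sub>\<phi>\<close> are an argument here since they are determined by
  \<open>\<phi>\<^sup>*\<eta> = d\<^sub>\<phi> \<eta>\<close> only if \<open>\<eta> \<noteq> 0\<close>.\<close>

definition height_controlled ::
    "'k :: field point set \<Rightarrow> ('k line_bundle set \<Rightarrow>\<^sub>0 real) set \<Rightarrow> ('k point \<Rightarrow> real) \<Rightarrow>
     ('k point \<Rightarrow> 'k point) set \<Rightarrow> (('k point \<Rightarrow> 'k point) \<Rightarrow> real) \<Rightarrow> bool" where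
  "height_controlled V \<eta> h S d \<longleftrightarrow>
    (\<forall>\<phi>\<in>S. morphism V V \<phi> \<and> d \<phi> > 1 \<and>
       tensor_map (Pic V) (Pic_pullback V \<phi>) \<eta> = tensor_scale (Pic V) (d \<phi>) \<eta>) \<and>
    (SUP \<phi>\<in>S. height_const V h \<phi> (d \<phi>)) < \<infinity>"

definition height_controlled_log_discrete ::
    "'k :: field point set \<Rightarrow> ('k line_bundle set \<Rightarrow>\<^sub>0 real) set \<Rightarrow> ('k point \<Rightarrow> real) \<Rightarrow>
     ('k point \<Rightarrow> 'k point) set \<Rightarrow> bool" where
  "height_controlled_log_discrete V \<eta> h S \<longleftrightarrow>
    (\<exists>d. height_controlled V \<eta> h S d \<and>
      (\<exists>\<delta>>0. \<forall>\<phi>\<in>S. \<forall>\<psi>\<in>S. \<phi> \<noteq> \<psi> \<longrightarrow> \<bar>ln (d \<phi>) - ln (d \<psi>)\<bar> > \<delta>))"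

definition word_comp :: "'a set \<Rightarrow> ('a \<Rightarrow> 'a) list \<Rightarrow> 'a \<Rightarrow> 'a" where
  "word_comp V ws = foldr (compose V) ws (\<lambda>P\<in>V. P)"

definition endo_monoid :: "'a set \<Rightarrow> ('a \<Rightarrow> 'a) set \<Rightarrow> ('a \<Rightarrow> 'a) set" where
  "endo_monoid V S = word_comp V ` lists S"

definition orbit :: "'a set \<Rightarrow> ('a \<Rightarrow> 'a) set \<Rightarrow> 'a \<Rightarrow> 'a set" where
  "orbit V S P = {f P | f. f \<in> endo_monoid V S}"

definition free_nonabelian :: "'a set \<Rightarrow> ('a \<Rightarrow> 'a) set \<Rightarrow> bool" where
  "free_nonabelian V S \<longleftrightarrow>
    (\<exists>\<phi>\<in>S. \<exists>\<psi>\<in>S. \<phi> \<noteq> \<psi>) \<and>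
    (\<forall>\<theta>\<in>lists S. \<forall>\<tau>\<in>lists S. word_comp V \<theta> = word_comp V \<tau> \<longrightarrow> \<theta> = \<tau>)"

definition vinogradov :: "(real \<Rightarrow> real) \<Rightarrow> (real \<Rightarrow> real) \<Rightarrow> bool" (infix \<open>\<lless>\<close> 50) where
  "F \<lless> G \<longleftrightarrow> (\<exists>c>0. \<exists>B0. \<forall>B\<ge>B0. F B \<le> c * G B)"

end

theory Submission
  imports Defs
begin

text \<open>Give a word in the letters \<open>\<phi> \<in> S\<close> the weight \<open>\<Sum> ln d\<^sub>\<phi>\<close>.  If \<open>h(P)\<close>
  exceeds \<open>A = C / (min d\<^sub>\<phi> - 1)\<close>, where \<open>C\<close> bounds all the constants \<open>C(V, \<eta>, \<phi>)\<close>, then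
  telescoping shows that \<open>h(f(P))\<close> agrees with \<open>exp (weight f) \<cdot> h(P)\<close> up to constant factors, so the
  problem is to count the words of weight at most \<open>T\<close>.  Splitting off the first letter, their number
  is at most a constant times \<open>exp (s T)\<close> if \<open>\<Sum> d\<^sub>\<phi> powr (-s) < 1\<close>, and at least such a multiple
  if the sum is at least 1.  The critical exponent between the two ranges is finite since the
  \<open>ln d\<^sub>\<phi>\<close> are uniformly separated, and positive if \<open>S\<close> has two elements.\<close>

section \<open>Words of bounded weight\<close>

text \<open>The alphabet may be infinite. The lower bound \<open>m\<close> limits the length of a
  word of given weight, and \<open>finite_letters\<close> limits the letters that can occur in it,
  so only finitely many words lie below a given weight.\<close>

locale weighted_letters =
  fixes S :: "'a set" and l :: "'a \<Rightarrow> real" and m :: real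
  assumes m_pos: "0 < m"
    and m_le: "\<phi> \<in> S \<Longrightarrow> m \<le> l \<phi>"
    and finite_letters: "finite {\<phi>\<in>S. l \<phi> \<le> T}"
begin

definition weight :: "'a list \<Rightarrow> real" where
  "weight w = sum_list (map l w)"

definition words_upto :: "real \<Rightarrow> 'a list set" where
  "words_upto T = {w\<in>lists S. weight w \<le> T}"

lemma weight_simps [simp]: "weight [] = 0" "weight (\<phi> # w) = l \<phi> + weight w"
  by (simp_all add: weight_def)

lemma weight_nonneg: "w \<in> lists S \<Longrightarrow> 0 \<le> weight w"
proof (induction w)
  case (Cons \<phi> w)
  then show ?case using m_pos m_le[of \<phi>] by simp
qed simp

lemma words_upto_neg: "T < 0 \<Longrightarrow> words_upto T = {}"
  using weight_nonneg by (fastforce simp: words_upto_def)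

lemma words_upto_split:
  assumes "0 \<le> T"
  shows "words_upto T = insert [] (\<Union>\<phi>\<in>{\<phi>\<in>S. l \<phi> \<le> T}. (#) \<phi> ` words_upto (T - l \<phi>))"
    (is "_ = ?R")
proof
  show "words_upto T \<subseteq> ?R"
  proof
    fix w assume w: "w \<in> words_upto T"
    show "w \<in> ?R"
    proof (cases w)
      case (Cons \<phi> u)
      then have "\<phi> \<in> S" "u \<in> lists S" "l \<phi> + weight u \<le> T"
        using w by (auto simp: words_upto_def)
      moreover from this have "l \<phi> \<le> T"
        using weight_nonneg[of u] by simp
      moreover have "u \<in> words_upto (T - l \<phi>)"
        using calculation by (simp add: words_upto_def)
      ultimately show ?thesis
        by (auto simp: Cons)
    qed simp
  qed
  show "?R \<subseteq> words_upto T"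
    using assms by (auto simp: words_upto_def)
qed

text \<open>Removing a letter lowers the real bound \<open>T\<close> by at least \<open>m\<close>,
  so ordinary induction on some \<open>k\<close> with \<open>T < k * m\<close> suffices. For
  negative \<open>T\<close> no letter fits, and the hypothesis of \<open>step\<close> is
  vacuous.\<close>

lemma weight_induct [case_names step]:
  assumes step: "\<And>T. (\<And>\<phi>. \<phi> \<in> S \<Longrightarrow> l \<phi> \<le> T \<Longrightarrow> P (T - l \<phi>)) \<Longrightarrow> P T"
  shows "P T"
proof -
  have "P T" if "T < real k * m" for k T
    using that
  proof (induction k arbitrary: T)
    case 0
    show ?case
    proof (rule step)
      fix \<phi> assume "\<phi> \<in> S" "l \<phi> \<le> T"
      then show "P (T - l \<phi>)" using 0 m_pos m_le[of \<phi>] by simp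
    qed
  next
    case (Suc k)
    show ?case
    proof (rule step)
      fix \<phi> assume "\<phi> \<in> S" "l \<phi> \<le> T"
      then have "T - l \<phi> < real k * m"
        using Suc.prems m_le[of \<phi>] by (simp add: algebra_simps)
      then show "P (T - l \<phi>)" by (rule Suc.IH)
    qed
  qed
  moreover obtain k where "T < real k * m"
    using reals_Archimedean3[OF m_pos] by blast
  ultimately show ?thesis by blast
qed

lemma finite_words_upto: "finite (words_upto T)"
proof (induction T rule: weight_induct)
  case (step T)
  then show ?case
    using finite_letters[of T] words_upto_neg[of T] words_upto_split[of T]
    by (cases "0 \<le> T") auto
qed

section \<open>Exponential bounds from the recursion on the first letter\<close>

lemma card_words_upto:
  assumes "0 \<le> T"
  shows "card (words_upto T) = 1 + (\<Sum>\<phi> | \<phi> \<in> S \<and> l \<phi> \<le> T. card (words_upto (T - l \<phi>)))"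
proof -
  let ?U = "\<Union>\<phi>\<in>{\<phi>\<in>S. l \<phi> \<le> T}. (#) \<phi> ` words_upto (T - l \<phi>)"
  have "card ?U = (\<Sum>\<phi> | \<phi> \<in> S \<and> l \<phi> \<le> T. card ((#) \<phi> ` words_upto (T - l \<phi>)))"
    by (rule card_UN_disjoint) (auto simp: finite_letters finite_words_upto)
  also have "\<dots> = (\<Sum>\<phi> | \<phi> \<in> S \<and> l \<phi> \<le> T. card (words_upto (T - l \<phi>)))"
    by (simp add: card_image)
  finally have U: "card ?U = \<dots>" .
  have "finite ?U"
    by (simp add: finite_letters finite_words_upto)
  moreover have "[] \<notin> ?U" by auto
  ultimately show ?thesis
    unfolding words_upto_split[OF assms] by (simp add: U)
qed

text \<open>The bound reproduces itself under the recursion: the letters contribute at most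
  \<open>q\<close> times it, the empty word contributes 1, which is at most
  \<open>exp (s * T)\<close>, and 1 + q / (1 - q) = 1 / (1 - q). Assuming \<open>Z\<close> for
  finite subsets avoids any question of convergence when \<open>S\<close> is infinite.\<close>

lemma card_words_upto_le:
  assumes "q < 1" and Z: "\<And>F. finite F \<Longrightarrow> F \<subseteq> S \<Longrightarrow> (\<Sum>\<phi>\<in>F. exp (- s * l \<phi>)) \<le> q"
    and "0 \<le> s"
  shows "real (card (words_upto T)) \<le> exp (s * T) / (1 - q)"
proof (induction T rule: weight_induct)
  case (step T)
  have q: "0 \<le> q" using Z[of "{}"] by simp
  show ?case
  proof (cases "0 \<le> T")
    case False
    then show ?thesis using \<open>q < 1\<close> by (simp add: words_upto_neg)
  next
    case True
    let ?F = "{\<phi>\<in>S. l \<phi> \<le> T}"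
    have "real (card (words_upto T)) = 1 + (\<Sum>\<phi>\<in>?F. real (card (words_upto (T - l \<phi>))))"
      by (simp add: card_words_upto[OF True])
    also have "\<dots> \<le> 1 + (\<Sum>\<phi>\<in>?F. exp (s * (T - l \<phi>)) / (1 - q))"
      by (intro add_left_mono sum_mono step.IH) auto
    also have "\<dots> = 1 + exp (s * T) / (1 - q) * (\<Sum>\<phi>\<in>?F. exp (- s * l \<phi>))"
      by (simp add: sum_distrib_left exp_diff exp_minus field_simps)
    also have "\<dots> \<le> exp (s * T) + exp (s * T) / (1 - q) * q"
      using Z[of ?F] finite_letters \<open>q < 1\<close> True \<open>0 \<le> s\<close>
      by (intro add_mono mult_left_mono) auto
    also have "\<dots> = exp (s * T) / (1 - q)"
      using \<open>q < 1\<close> by (simp add: field_simps)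
    finally show ?thesis .
  qed
qed

lemma card_words_upto_ge:
  assumes "finite F" "F \<subseteq> S" and Z: "1 \<le> (\<Sum>\<phi>\<in>F. exp (- s * l \<phi>))" and "0 \<le> s"
  obtains c where "0 < c" "\<And>T. 0 \<le> T \<Longrightarrow> c * exp (s * T) \<le> real (card (words_upto T))"
proof -
  have "F \<noteq> {}" using Z by auto
  define M where "M = Max (l ` F)"
  have M: "l \<phi> \<le> M" if "\<phi> \<in> F" for \<phi>
    using that \<open>finite F\<close> by (simp add: M_def)
  \<comment> \<open>The constant is chosen for the range T \<le> M, where the empty word alone gives
    the bound. Above \<open>M\<close> every letter of \<open>F\<close> fits and leaves a nonnegative
    remainder, so the induction hypothesis applies.\<close>
  have "0 \<le> T \<longrightarrow> exp (- s * M) * exp (s * T) \<le> real (card (words_upto T))" for T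
  proof (induction T rule: weight_induct)
    case (step T)
    show ?case
    proof
      assume T: "0 \<le> T"
      show "exp (- s * M) * exp (s * T) \<le> real (card (words_upto T))"
      proof (cases "T \<le> M")
        case True
        then have "exp (- s * M) * exp (s * T) \<le> 1"
          using \<open>0 \<le> s\<close> by (simp flip: exp_add add: mult_left_mono)
        also have "1 \<le> real (card (words_upto T))"
          by (simp add: card_words_upto[OF T] sum_nonneg)
        finally show ?thesis .
      next
        case False
        let ?c = "exp (- s * M)"
        have F: "F \<subseteq> {\<phi>\<in>S. l \<phi> \<le> T}"
          using M False \<open>F \<subseteq> S\<close> by fastforce
        have "?c * exp (s * T) \<le> ?c * exp (s * T) * (\<Sum>\<phi>\<in>F. exp (- s * l \<phi>))"
          using mult_left_mono[OF Z, of "?c * exp (s * T)"] by simp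
        also have "\<dots> = (\<Sum>\<phi>\<in>F. ?c * exp (s * (T - l \<phi>)))"
          by (simp add: sum_distrib_left exp_diff exp_minus field_simps)
        also have "\<dots> \<le> (\<Sum>\<phi>\<in>F. real (card (words_upto (T - l \<phi>))))"
          using F step by (intro sum_mono) auto
        also have "\<dots> \<le> (\<Sum>\<phi> | \<phi> \<in> S \<and> l \<phi> \<le> T. real (card (words_upto (T - l \<phi>))))"
          using F finite_letters by (intro sum_mono2) auto
        also have "\<dots> \<le> real (card (words_upto T))"
          by (simp add: card_words_upto[OF T])
        finally show ?thesis .
      qed
    qed
  qed
  then show thesis
    by (intro that[of "exp (- s * M)"]) auto
qed

end

section \<open>The critical exponent\<close>

locale log_discrete_letters =
  fixes S :: "'a set" and l :: "'a \<Rightarrow> real" and \<delta> :: real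
  assumes \<delta>_pos: "0 < \<delta>"
    and l_pos: "\<phi> \<in> S \<Longrightarrow> 0 < l \<phi>"
    and separated: "\<phi> \<in> S \<Longrightarrow> \<psi> \<in> S \<Longrightarrow> \<phi> \<noteq> \<psi> \<Longrightarrow> \<delta> < \<bar>l \<phi> - l \<psi>\<bar>"
begin

definition level :: "'a \<Rightarrow> nat" where
  "level \<phi> = nat \<lfloor>l \<phi> / \<delta>\<rfloor>"

lemma level_le: "\<phi> \<in> S \<Longrightarrow> real (level \<phi>) * \<delta> \<le> l \<phi>"
  using l_pos[of \<phi>] \<delta>_pos by (simp add: level_def flip: pos_le_divide_eq)

text \<open>Levels cut the half-line into intervals of length \<delta>, and two letters in the same
  interval would be closer than the separation permits.\<close>

lemma inj_on_level: "inj_on level S"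
proof (rule inj_onI, rule ccontr)
  fix \<phi> \<psi>
  assume *: "\<phi> \<in> S" "\<psi> \<in> S" "level \<phi> = level \<psi>" "\<phi> \<noteq> \<psi>"
  then have "\<lfloor>l \<phi> / \<delta>\<rfloor> = \<lfloor>l \<psi> / \<delta>\<rfloor>"
    using \<delta>_pos l_pos[of \<phi>] l_pos[of \<psi>] by (simp add: level_def eq_nat_nat_iff)
  then have "\<bar>l \<phi> / \<delta> - l \<psi> / \<delta>\<bar> < 1"
    by linarith
  then have "\<bar>l \<phi> - l \<psi>\<bar> < \<delta>"
    using \<delta>_pos by (simp flip: diff_divide_distrib add: abs_divide)
  then show False
    using separated[of \<phi> \<psi>] * by simp
qed

lemma finite_bounded: "finite {\<phi>\<in>S. l \<phi> \<le> T}"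
proof (rule inj_on_finite[OF inj_on_subset[OF inj_on_level]])
  show "level ` {\<phi>\<in>S. l \<phi> \<le> T} \<subseteq> {..nat \<lfloor>T / \<delta>\<rfloor>}"
    using \<delta>_pos by (auto simp: level_def intro!: nat_mono floor_mono divide_right_mono)
qed auto

text \<open>Positivity of each weight does not bound an infinite set of weights away from 0. Only
  finitely many are at most 1, however, so a minimum exists; the inserted 1 covers the heavier
  letters and the case that there are no light ones.\<close>

definition min_weight :: real where
  "min_weight = Min (insert 1 (l ` {\<phi>\<in>S. l \<phi> \<le> 1}))"

sublocale weighted_letters S l min_weight
proof
  have fin: "finite (insert 1 (l ` {\<phi>\<in>S. l \<phi> \<le> 1}))"
    by (simp add: finite_bounded)
  then show "0 < min_weight"
    using l_pos by (auto simp: min_weight_def)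
  show "min_weight \<le> l \<phi>" if "\<phi> \<in> S" for \<phi>
  proof (cases "l \<phi> \<le> 1")
    case True
    then show ?thesis
      using that unfolding min_weight_def by (intro Min_le fin) auto
  next
    case False
    have "min_weight \<le> 1"
      unfolding min_weight_def by (intro Min_le fin) auto
    with False show ?thesis by simp
  qed
qed (rule finite_bounded)

text \<open>Half of the exponent \<open>s * l \<phi>\<close> is spent on a constant factor 1/4, by
  the minimal weight, and half on a factor 1/2 for each level. As levels are distinct, a geometric
  series with sum 2 bounds the rest.\<close>

lemma exists_large_exponent:
  obtains s where "0 < s" "\<And>F. finite F \<Longrightarrow> F \<subseteq> S \<Longrightarrow> (\<Sum>\<phi>\<in>F. exp (- s * l \<phi>)) \<le> 1 / 2"
proof -
  define s where "s = max (2 * ln 4 / min_weight) (2 * ln 2 / \<delta>)"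
  have s_pos: "0 < s"
    using m_pos by (simp add: s_def less_max_iff_disj)
  have s1: "ln 4 \<le> s * min_weight / 2"
    using m_pos by (simp add: s_def flip: pos_divide_le_eq) (simp add: field_simps max_def)
  have s2: "ln 2 \<le> s * \<delta> / 2"
    using \<delta>_pos by (simp add: s_def flip: pos_divide_le_eq) (simp add: field_simps max_def)
  have bound: "exp (- s * l \<phi>) \<le> 1 / 4 * (1 / 2) ^ level \<phi>" if "\<phi> \<in> S" for \<phi>
  proof -
    have "ln 4 + real (level \<phi>) * ln 2 \<le> s * min_weight / 2 + real (level \<phi>) * (s * \<delta> / 2)"
      by (intro add_mono mult_left_mono s1 s2) auto
    also have "\<dots> = s / 2 * min_weight + s / 2 * (real (level \<phi>) * \<delta>)"
      by simp
    also have "\<dots> \<le> s / 2 * l \<phi> + s / 2 * l \<phi>"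
      using s_pos m_le[OF that] level_le[OF that] by (intro add_mono mult_left_mono) auto
    finally have "exp (- s * l \<phi>) \<le> exp (- (ln 4 + real (level \<phi>) * ln 2))"
      by simp
    also have "\<dots> = 1 / 4 * (1 / 2) ^ level \<phi>"
      by (simp add: exp_diff exp_minus exp_of_nat2_mult power_one_over field_simps)
    finally show ?thesis .
  qed
  have "(\<Sum>\<phi>\<in>F. exp (- s * l \<phi>)) \<le> 1 / 2" if F: "finite F" "F \<subseteq> S" for F
  proof -
    have "(\<Sum>\<phi>\<in>F. exp (- s * l \<phi>)) \<le> (\<Sum>\<phi>\<in>F. 1 / 4 * (1 / 2) ^ level \<phi>)"
      using F bound by (intro sum_mono) auto
    also have "\<dots> = 1 / 4 * (\<Sum>k\<in>level ` F. (1 / 2) ^ k)"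
      by (simp add: sum.reindex[OF inj_on_subset[OF inj_on_level F(2)]] sum_distrib_left)
    also have "\<dots> \<le> 1 / 4 * suminf (\<lambda>k. (1 / 2) ^ k)"
      using F(1) by (intro mult_left_mono sum_le_suminf) auto
    also have "\<dots> = 1 / 2"
      by (simp add: suminf_geometric)
    finally show ?thesis .
  qed
  with s_pos show thesis by (rule that)
qed

lemma exp_upper_bound:
  obtains s c where "0 < s" "0 < c" "\<And>T. real (card (words_upto T)) \<le> c * exp (s * T)"
proof -
  obtain s where s: "0 < s" "\<And>F. finite F \<Longrightarrow> F \<subseteq> S \<Longrightarrow> (\<Sum>\<phi>\<in>F. exp (- s * l \<phi>)) \<le> 1 / 2"
    using exists_large_exponent by blast
  then have "real (card (words_upto T)) \<le> 2 * exp (s * T)" for T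
    using card_words_upto_le[of "1/2" s T] by simp
  with s(1) show thesis by (intro that[of s 2]) auto
qed

text \<open>The critical exponent is the supremum of \<open>E\<close>, the exponents at which some
  finite sum reaches 1. An \<open>s\<close> in \<open>E\<close> less than \<epsilon>/2 below it
  gives the lower bound. Passing to \<open>s + \<epsilon>\<close> goes beyond the supremum with room
  to spare for the upper bound.\<close>

lemma exp_two_sided_bound:
  assumes "\<phi> \<in> S" "\<psi> \<in> S" "\<phi> \<noteq> \<psi>" "0 < \<epsilon>"
  obtains s c c' where "0 < s" "0 < c" "0 < c'"
    "\<And>T. 0 \<le> T \<Longrightarrow> c * exp (s * T) \<le> real (card (words_upto T))"
    "\<And>T. real (card (words_upto T)) \<le> c' * exp ((s + \<epsilon>) * T)"
proof -
  define Z where "Z F s = (\<Sum>\<phi>\<in>F. exp (- s * l \<phi>))" for F s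
  define E where "E = {s. 0 < s \<and> (\<exists>F. finite F \<and> F \<subseteq> S \<and> 1 \<le> Z F s)}"
  \<comment> \<open>Every letter weighs at least \<open>min_weight\<close>, so raising the exponent
    shrinks all terms by a common factor that does not depend on \<open>F\<close>.\<close>
  have Z_mono: "Z F t \<le> exp (- (t - s) * min_weight) * Z F s" if "F \<subseteq> S" "s \<le> t" for F s t
  proof -
    have "exp (- t * l \<theta>) \<le> exp (- (t - s) * min_weight) * exp (- s * l \<theta>)" if "\<theta> \<in> F" for \<theta>
    proof -
      have "(t - s) * min_weight \<le> (t - s) * l \<theta>"
        using \<open>\<theta> \<in> F\<close> \<open>F \<subseteq> S\<close> \<open>s \<le> t\<close> m_le by (intro mult_left_mono) auto
      then show ?thesis by (simp flip: exp_add add: algebra_simps)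
    qed
    then show ?thesis
      unfolding Z_def sum_distrib_left by (intro sum_mono)
  qed
  obtain s0 where s0: "0 < s0" "\<And>F. finite F \<Longrightarrow> F \<subseteq> S \<Longrightarrow> Z F s0 \<le> 1 / 2"
    using exists_large_exponent unfolding Z_def by blast
  have E_le: "s \<le> s0" if "s \<in> E" for s
  proof (rule ccontr)
    assume "\<not> s \<le> s0"
    then have "s0 \<le> s" by simp
    obtain F where F: "finite F" "F \<subseteq> S" "1 \<le> Z F s"
      using \<open>s \<in> E\<close> by (auto simp: E_def)
    have "Z F s \<le> exp (- (s - s0) * min_weight) * Z F s0"
      by (rule Z_mono) fact+
    also have "\<dots> \<le> 1 * (1 / 2)"
      using s0(2)[OF F(1,2)] \<open>s0 \<le> s\<close> m_pos
      by (intro mult_mono) (auto simp: Z_def sum_nonneg mult_nonpos_nonneg)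
    finally show False using F(3) by simp
  qed
  then have bdd: "bdd_above E" by (intro bdd_aboveI)
  define M where "M = max (l \<phi>) (l \<psi>)"
  have M: "l \<phi> \<le> M" "l \<psi> \<le> M" "0 < M"
    using l_pos[OF assms(1)] by (auto simp: M_def less_max_iff_disj)
  have half: "1 / 2 \<le> exp (- (ln 2 / M) * l \<theta>)" if "\<theta> = \<phi> \<or> \<theta> = \<psi>" for \<theta>
  proof -
    have "ln 2 / M * l \<theta> \<le> ln 2 / M * M"
      using M that by (intro mult_left_mono) auto
    also have "\<dots> = ln 2" using M by simp
    finally have "exp (- ln 2) \<le> exp (- (ln 2 / M) * l \<theta>)" by simp
    then show ?thesis by (simp add: exp_minus)
  qed
  \<comment> \<open>At the exponent \<open>ln 2 / M\<close> each of the two letters contributes at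
    least 1/2; this makes \<open>E\<close> nonempty.\<close>
  have "1 \<le> Z {\<phi>, \<psi>} (ln 2 / M)"
    using half[of \<phi>] half[of \<psi>] assms(3) by (simp add: Z_def)
  then have "ln 2 / M \<in> E"
    using assms(1,2) M(3) unfolding E_def by (auto intro!: exI[of _ "{\<phi>, \<psi>}"])
  then have "E \<noteq> {}" by auto
  then obtain s where s: "s \<in> E" "Sup E - \<epsilon> / 2 < s"
    using less_cSup_iff[OF _ bdd, of "Sup E - \<epsilon> / 2"] \<open>0 < \<epsilon>\<close> by auto
  then obtain F where F: "finite F" "F \<subseteq> S" "1 \<le> Z F s" and s_pos: "0 < s"
    by (auto simp: E_def)
  obtain c where c: "0 < c" "\<And>T. 0 \<le> T \<Longrightarrow> c * exp (s * T) \<le> real (card (words_upto T))"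
    using card_words_upto_ge[OF F(1,2), of s] F(3) s_pos unfolding Z_def by auto
  \<comment> \<open>Outside \<open>E\<close> each finite sum is below 1, but possibly not uniformly
    so. The first \<epsilon>/2 leaves \<open>E\<close>, and the second one gains the uniform factor
    \<open>q\<close>.\<close>
  define q where "q = exp (- (\<epsilon> / 2) * min_weight)"
  have q: "q < 1" using \<open>0 < \<epsilon>\<close> m_pos by (simp add: q_def)
  have Zq: "Z F (s + \<epsilon>) \<le> q" if F: "finite F" "F \<subseteq> S" for F
  proof -
    have "s + \<epsilon> / 2 \<notin> E"
      using s(2) cSup_upper[OF _ bdd, of "s + \<epsilon> / 2"] by auto
    moreover have "0 < s + \<epsilon> / 2" using s_pos \<open>0 < \<epsilon>\<close> by simp
    ultimately have "\<not> 1 \<le> Z F (s + \<epsilon> / 2)"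
      using F unfolding E_def by blast
    then have "Z F (s + \<epsilon> / 2) \<le> 1" by simp
    have "Z F (s + \<epsilon>) \<le> q * Z F (s + \<epsilon> / 2)"
      using Z_mono[OF F(2), of "s + \<epsilon> / 2" "s + \<epsilon>"] \<open>0 < \<epsilon>\<close> by (simp add: q_def)
    also have "\<dots> \<le> q * 1"
      by (intro mult_left_mono) (use \<open>Z F (s + \<epsilon> / 2) \<le> 1\<close> in \<open>auto simp: q_def\<close>)
    finally show ?thesis by simp
  qed
  have "real (card (words_upto T)) \<le> 1 / (1 - q) * exp ((s + \<epsilon>) * T)" for T
    using card_words_upto_le[OF q, of "s + \<epsilon>" T] Zq s_pos \<open>0 < \<epsilon>\<close> by (simp add: Z_def)
  with c s_pos q show thesis
    by (intro that[of s c "1 / (1 - q)"]) auto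
qed

end

section \<open>Heights along words\<close>

lemma word_comp_Cons: "P \<in> V \<Longrightarrow> word_comp V (\<phi> # w) P = \<phi> (word_comp V w P)"
  by (simp add: word_comp_def compose_def)

lemma word_comp_Nil: "P \<in> V \<Longrightarrow> word_comp V [] P = P"
  by (simp add: word_comp_def)

lemma word_comp_mem:
  assumes "\<And>\<phi>. \<phi> \<in> S \<Longrightarrow> \<phi> \<in> V \<rightarrow> V" "P \<in> V" "w \<in> lists S"
  shows "word_comp V w P \<in> V"
  using assms(3) by (induction w) (use assms(1,2) in \<open>auto simp: word_comp_Nil word_comp_Cons\<close>)

lemma height_controlledD:
  assumes "height_controlled V \<eta> h S d"
  obtains C where "0 \<le> C" "\<And>\<phi> P. \<phi> \<in> S \<Longrightarrow> P \<in> V \<Longrightarrow> \<bar>h (\<phi> P) - d \<phi> * h P\<bar> \<le> C"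
proof -
  define s where "s = (SUP \<phi>\<in>S. height_const V h \<phi> (d \<phi>))"
  have "s < \<infinity>" using assms by (simp add: height_controlled_def s_def)
  \<comment> \<open>The maximum with 0 is taken because the supremum is -\<infinity> when
    \<open>S\<close> is empty.\<close>
  then have "max 0 s \<noteq> \<infinity>" "max 0 s \<noteq> -\<infinity>" by (auto simp: max_def)
  then obtain C where C: "max 0 s = ereal C" by (cases "max 0 s") auto
  show thesis
  proof (rule that[of C])
    show "0 \<le> C" using C by (metis ereal_less_eq(5) max.cobounded1)
    fix \<phi> P assume "\<phi> \<in> S" "P \<in> V"
    have "ereal \<bar>h (\<phi> P) - d \<phi> * h P\<bar> \<le> height_const V h \<phi> (d \<phi>)"
      unfolding height_const_def using \<open>P \<in> V\<close> by (intro Inf_greatest) auto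
    also have "\<dots> \<le> s" unfolding s_def using \<open>\<phi> \<in> S\<close> by (rule SUP_upper)
    also have "\<dots> \<le> ereal C" by (metis C max.cobounded2)
    finally show "\<bar>h (\<phi> P) - d \<phi> * h P\<bar> \<le> C" by simp
  qed
qed

locale controlled_maps = log_discrete_letters S "\<lambda>\<phi>. ln (d \<phi>)" \<delta>
  for S :: "('a \<Rightarrow> 'a) set" and d :: "('a \<Rightarrow> 'a) \<Rightarrow> real" and \<delta> :: real +
  fixes V :: "'a set" and h :: "'a \<Rightarrow> real" and C :: real
  assumes maps: "\<phi> \<in> S \<Longrightarrow> \<phi> \<in> V \<rightarrow> V"
    and d_gt_1: "\<phi> \<in> S \<Longrightarrow> 1 < d \<phi>"
    and C_nonneg: "0 \<le> C"
    and controlled: "\<phi> \<in> S \<Longrightarrow> P \<in> V \<Longrightarrow> \<bar>h (\<phi> P) - d \<phi> * h P\<bar> \<le> C"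
begin

text \<open>With this shift, the additive error \<open>C\<close> in one application of \<phi> is at
  most \<open>(d \<phi> - 1) * A\<close> for all letters at once. As \<open>min_weight\<close> is
  capped at 1, \<open>exp min_weight\<close> can lie below the smallest degree.\<close>

definition A :: real where
  "A = C / (exp min_weight - 1)"

lemma A_nonneg: "0 \<le> A"
  using C_nonneg m_pos by (simp add: A_def)

lemma C_le: "\<phi> \<in> S \<Longrightarrow> C \<le> (d \<phi> - 1) * A"
proof -
  assume "\<phi> \<in> S"
  then have "exp min_weight \<le> exp (ln (d \<phi>))"
    using m_le[of \<phi>] by simp
  then have "exp min_weight \<le> d \<phi>"
    using d_gt_1[OF \<open>\<phi> \<in> S\<close>] by simp
  then have "(exp min_weight - 1) * A \<le> (d \<phi> - 1) * A"
    using A_nonneg by (intro mult_right_mono) auto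
  then show ?thesis using m_pos by (simp add: A_def)
qed

text \<open>Shifting the height by \<open>A\<close> absorbs the error of each step: applying \<phi>
  multiplies \<open>h - A\<close> by at least \<open>d \<phi>\<close> and \<open>h + A\<close> by at
  most \<open>d \<phi>\<close>. The estimates therefore compose along a word without accumulating
  error terms.\<close>

lemma height_word:
  assumes "P \<in> V" "w \<in> lists S"
  shows "exp (weight w) * (h P - A) \<le> h (word_comp V w P) - A"
    and "h (word_comp V w P) + A \<le> exp (weight w) * (h P + A)"
proof -
  have "exp (weight w) * (h P - A) \<le> h (word_comp V w P) - A \<and>
        h (word_comp V w P) + A \<le> exp (weight w) * (h P + A)"
    using assms(2)
  proof (induction w)
    case Nil
    then show ?case using \<open>P \<in> V\<close> by (simp add: word_comp_Nil)
  next
    case (Cons \<phi> w)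
    define Q where "Q = word_comp V w P"
    have "\<phi> \<in> S" and "Q \<in> V"
      using Cons \<open>P \<in> V\<close> word_comp_mem[OF maps] by (auto simp: Q_def)
    have d: "1 < d \<phi>" by (rule d_gt_1) fact
    have hQ: "\<bar>h (\<phi> Q) - d \<phi> * h Q\<bar> \<le> (d \<phi> - 1) * A"
      using controlled[OF \<open>\<phi> \<in> S\<close> \<open>Q \<in> V\<close>] C_le[OF \<open>\<phi> \<in> S\<close>] by simp
    have e: "exp (weight (\<phi> # w)) = d \<phi> * exp (weight w)"
      using d by (simp add: exp_add)
    have "exp (weight (\<phi> # w)) * (h P - A) \<le> d \<phi> * (h Q - A)"
      unfolding e mult.assoc using Cons d by (intro mult_left_mono) (auto simp: Q_def)
    also have "\<dots> \<le> h (\<phi> Q) - A" using hQ by (simp add: abs_le_iff algebra_simps)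
    finally have 1: "exp (weight (\<phi> # w)) * (h P - A) \<le> h (\<phi> Q) - A" .
    have "h (\<phi> Q) + A \<le> d \<phi> * (h Q + A)" using hQ by (simp add: abs_le_iff algebra_simps)
    also have "\<dots> \<le> exp (weight (\<phi> # w)) * (h P + A)"
      unfolding e mult.assoc using Cons d by (intro mult_left_mono) (auto simp: Q_def)
    finally show ?case
      using 1 \<open>P \<in> V\<close> by (simp add: word_comp_Cons Q_def)
  qed
  then show "exp (weight w) * (h P - A) \<le> h (word_comp V w P) - A"
    and "h (word_comp V w P) + A \<le> exp (weight w) * (h P + A)" by auto
qed

section \<open>Counting words by the height of the image point\<close>

definition low_words :: "'a \<Rightarrow> real \<Rightarrow> ('a \<Rightarrow> 'a) list set" where
  "low_words P B = {w\<in>lists S. exp (h (word_comp V w P)) \<le> B}"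

lemma low_words_subset:
  assumes "P \<in> V" "A < h P"
  shows "low_words P B \<subseteq> words_upto (ln ((ln B - A) / (h P - A)))"
proof
  fix w assume "w \<in> low_words P B"
  then have w: "w \<in> lists S" "exp (h (word_comp V w P)) \<le> B"
    by (auto simp: low_words_def)
  then have "0 < B" by (meson exp_gt_zero less_le_trans)
  then have "h (word_comp V w P) \<le> ln B"
    using w(2) by (simp add: ln_ge_iff)
  then have "exp (weight w) * (h P - A) \<le> ln B - A"
    using height_word(1)[OF assms(1) w(1)] by simp
  then have *: "exp (weight w) \<le> (ln B - A) / (h P - A)"
    using assms(2) by (simp add: pos_le_divide_eq)
  \<comment> \<open>The word at hand itself shows that the quotient is positive, so its logarithm is
    meaningful; for small \<open>B\<close> there is no such word.\<close>
  moreover from * have "0 < (ln B - A) / (h P - A)"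
    by (meson exp_gt_zero less_le_trans)
  ultimately have "weight w \<le> ln ((ln B - A) / (h P - A))"
    by (simp add: ln_ge_iff)
  with w show "w \<in> words_upto (ln ((ln B - A) / (h P - A)))"
    by (simp add: words_upto_def)
qed

lemma words_upto_subset_low_words:
  assumes "P \<in> V" "A < h P" "1 < B"
  shows "words_upto (ln (ln B / (h P + A))) \<subseteq> low_words P B"
proof
  fix w assume "w \<in> words_upto (ln (ln B / (h P + A)))"
  then have w: "w \<in> lists S" "weight w \<le> ln (ln B / (h P + A))"
    by (auto simp: words_upto_def)
  have pos: "0 < h P + A" using assms A_nonneg by simp
  then have "0 < ln B / (h P + A)" using \<open>1 < B\<close> by simp
  then have "exp (weight w) \<le> ln B / (h P + A)"
    using w(2) by (simp add: ln_ge_iff)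
  then have "exp (weight w) * (h P + A) \<le> ln B"
    using pos by (simp add: pos_le_divide_eq)
  then have "h (word_comp V w P) \<le> ln B"
    using height_word(2)[OF assms(1) w(1)] A_nonneg by simp
  then have "exp (h (word_comp V w P)) \<le> B"
    using \<open>1 < B\<close> by (simp add: ln_ge_iff)
  with w show "w \<in> low_words P B" by (simp add: low_words_def)
qed

text \<open>Since \<open>card\<close> is 0 on infinite sets, the counts below carry information only
  together with this finiteness.\<close>

lemma finite_low_words: "P \<in> V \<Longrightarrow> A < h P \<Longrightarrow> finite (low_words P B)"
  by (rule finite_subset[OF low_words_subset finite_words_upto])

lemma card_low_words_le:
  assumes "P \<in> V" "A < h P" "0 < s" "0 < c"
    and c: "\<And>T. real (card (words_upto T)) \<le> c * exp (s * T)"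
  shows "(\<lambda>B. real (card (low_words P B))) \<lless> (\<lambda>B. ln B powr s)"
  unfolding vinogradov_def
proof (intro exI conjI allI impI)
  let ?c = "c / (h P - A) powr s"
  show "0 < ?c" using assms by simp
  \<comment> \<open>This threshold makes \<open>ln B - A\<close> positive, so that the exponential
    of \<open>s\<close> times the logarithm is a genuine real power.\<close>
  fix B assume B: "exp (A + 1) \<le> B"
  then have "0 < B" by (meson exp_gt_zero less_le_trans)
  then have lnB: "A + 1 \<le> ln B" using B by (simp add: ln_ge_iff)
  then have pos: "0 < (ln B - A) / (h P - A)" using assms by simp
  have "real (card (low_words P B)) \<le> real (card (words_upto (ln ((ln B - A) / (h P - A)))))"
    using low_words_subset[OF assms(1,2)] finite_words_upto by (simp add: card_mono)
  also have "\<dots> \<le> c * exp (s * ln ((ln B - A) / (h P - A)))" by (rule c)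
  also have "\<dots> = c * ((ln B - A) / (h P - A)) powr s"
    using pos by (auto simp: powr_def)
  also have "\<dots> \<le> c * (ln B / (h P - A)) powr s"
    using assms A_nonneg lnB
    by (intro mult_left_mono powr_mono2 divide_right_mono) auto
  also have "\<dots> = ?c * ln B powr s"
    using assms A_nonneg lnB by (simp add: powr_divide)
  finally show "real (card (low_words P B)) \<le> ?c * ln B powr s" .
qed

lemma card_low_words_ge:
  assumes "P \<in> V" "A < h P" "0 < s" "0 < c"
    and c: "\<And>T. 0 \<le> T \<Longrightarrow> c * exp (s * T) \<le> real (card (words_upto T))"
  shows "(\<lambda>B. ln B powr s) \<lless> (\<lambda>B. real (card (low_words P B)))"
  unfolding vinogradov_def
proof (intro exI conjI allI impI)
  have hP: "0 < h P + A" using assms A_nonneg by simp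
  let ?c = "(h P + A) powr s / c"
  show "0 < ?c" using assms hP by simp
  \<comment> \<open>From this threshold on, the weight bound \<open>ln (ln B / (h P + A))\<close> is
    nonnegative, as the lower bound \<open>c\<close> requires.\<close>
  fix B assume B: "exp (h P + A) \<le> B"
  then have "0 < B" by (meson exp_gt_zero less_le_trans)
  then have lnB: "h P + A \<le> ln B" using B by (simp add: ln_ge_iff)
  then have "1 < B" using hP \<open>0 < B\<close> by (metis less_le_trans ln_gt_zero_iff)
  have 1: "1 \<le> ln B / (h P + A)" using lnB hP by simp
  have "c * (ln B powr s / (h P + A) powr s) = c * (ln B / (h P + A)) powr s"
    using hP lnB by (simp add: powr_divide)
  also have "\<dots> = c * exp (s * ln (ln B / (h P + A)))"
    using 1 by (auto simp: powr_def)
  also have "\<dots> \<le> real (card (words_upto (ln (ln B / (h P + A)))))"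
    using 1 by (intro c) simp
  also have "\<dots> \<le> real (card (low_words P B))"
    using words_upto_subset_low_words[OF assms(1,2) \<open>1 < B\<close>] finite_low_words[OF assms(1,2)]
    by (simp add: card_mono)
  finally show "ln B powr s \<le> ?c * real (card (low_words P B))"
    using \<open>0 < c\<close> hP by (simp add: field_simps)
qed

text \<open>Different words may lead to the same point, so this image transfers only upper bounds
  from words to the orbit. For maps in a free monoid the corresponding image is injective and both
  bounds transfer.\<close>

lemma orbit_low:
  "{Q\<in>orbit V S P. exp (h Q) \<le> B} = (\<lambda>w. word_comp V w P) ` low_words P B"
  by (auto simp: orbit_def endo_monoid_def low_words_def)

lemma endo_monoid_low:
  "{f\<in>endo_monoid V S. exp (h (f P)) \<le> B} = word_comp V ` low_words P B"
  by (auto simp: endo_monoid_def low_words_def)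

end

lemma vinogradov_mono_left:
  assumes "\<And>B. F B \<le> F' B" "F' \<lless> G"
  shows "F \<lless> G"
  using assms unfolding vinogradov_def by (meson order_trans)

section \<open>Counting in orbits and in free monoids\<close>

theorem theorem1p2:
  fixes V :: "'k :: field point set"
    and \<eta> :: "('k line_bundle set \<Rightarrow>\<^sub>0 real) set"
    and h :: "'k point \<Rightarrow> real"
    and S :: "('k point \<Rightarrow> 'k point) set"
  assumes "global_field TYPE('k)"
    and "projective_variety V"
    and "\<eta> \<in> tensor_real (Pic V)"
    and "weil_height V \<eta> h"
    and "height_controlled_log_discrete V \<eta> h S"
  shows
    "(\<exists>b>0. \<exists>BS :: real. \<forall>P\<in>V. exp (h P) > BS \<longrightarrow>
        (\<forall>B. finite {Q \<in> orbit V S P. exp (h Q) \<le> B}) \<and>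
        (\<lambda>B. real (card {Q \<in> orbit V S P. exp (h Q) \<le> B})) \<lless> (\<lambda>B. ln B powr b))
     \<and>
     (free_nonabelian V S \<longrightarrow>
        (\<exists>BS :: real. \<forall>\<epsilon>>0. \<exists>b>0. \<forall>P\<in>V. exp (h P) > BS \<longrightarrow>
          (\<forall>B. finite {f \<in> endo_monoid V S. exp (h (f P)) \<le> B}) \<and>
          (\<lambda>B. ln B powr b) \<lless> (\<lambda>B. real (card {f \<in> endo_monoid V S. exp (h (f P)) \<le> B})) \<and>
          (\<lambda>B. real (card {f \<in> endo_monoid V S. exp (h (f P)) \<le> B})) \<lless> (\<lambda>B. ln B powr (b + \<epsilon>))))"
proof -
  obtain d \<delta> where hc: "height_controlled V \<eta> h S d" and "0 < \<delta>"
    and sep: "\<And>\<phi> \<psi>. \<phi> \<in> S \<Longrightarrow> \<psi> \<in> S \<Longrightarrow> \<phi> \<noteq> \<psi> \<Longrightarrow> \<delta> < \<bar>ln (d \<phi>) - ln (d \<psi>)\<bar>"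
    using assms(5) unfolding height_controlled_log_discrete_def by blast
  obtain C where C: "0 \<le> C" "\<And>\<phi> P. \<phi> \<in> S \<Longrightarrow> P \<in> V \<Longrightarrow> \<bar>h (\<phi> P) - d \<phi> * h P\<bar> \<le> C"
    using height_controlledD[OF hc] by blast
  have d: "1 < d \<phi>" and maps: "\<phi> \<in> V \<rightarrow> V" if "\<phi> \<in> S" for \<phi>
    using hc that by (auto simp: height_controlled_def morphism_def)
  interpret controlled_maps S d \<delta> V h C
    by unfold_locales (use \<open>0 < \<delta>\<close> sep C d maps in \<open>auto intro: ln_gt_zero\<close>)
  have part1: "\<exists>b>0. \<exists>BS :: real. \<forall>P\<in>V. exp (h P) > BS \<longrightarrow>
        (\<forall>B. finite {Q \<in> orbit V S P. exp (h Q) \<le> B}) \<and>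
        (\<lambda>B. real (card {Q \<in> orbit V S P. exp (h Q) \<le> B})) \<lless> (\<lambda>B. ln B powr b)"
  proof -
    obtain s c where s: "0 < s" "0 < c" "\<And>T. real (card (words_upto T)) \<le> c * exp (s * T)"
      using exp_upper_bound by blast
    show ?thesis
    proof (rule exI[of _ s], rule conjI[OF s(1)], intro conjI exI[of _ "exp A"] ballI impI allI)
      fix P assume "P \<in> V" "exp A < exp (h P)"
      then have P: "P \<in> V" "A < h P" by auto
      show "finite {Q \<in> orbit V S P. exp (h Q) \<le> B}" for B
        unfolding orbit_low by (intro finite_imageI finite_low_words P)
      show "(\<lambda>B. real (card {Q \<in> orbit V S P. exp (h Q) \<le> B})) \<lless> (\<lambda>B. ln B powr s)"
        by (rule vinogradov_mono_left[OF _ card_low_words_le[OF P s]])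
          (simp add: orbit_low card_image_le finite_low_words P)
    qed
  qed
  have part2: "\<exists>BS :: real. \<forall>\<epsilon>>0. \<exists>b>0. \<forall>P\<in>V. exp (h P) > BS \<longrightarrow>
          (\<forall>B. finite {f \<in> endo_monoid V S. exp (h (f P)) \<le> B}) \<and>
          (\<lambda>B. ln B powr b) \<lless> (\<lambda>B. real (card {f \<in> endo_monoid V S. exp (h (f P)) \<le> B})) \<and>
          (\<lambda>B. real (card {f \<in> endo_monoid V S. exp (h (f P)) \<le> B})) \<lless> (\<lambda>B. ln B powr (b + \<epsilon>))"
    if free: "free_nonabelian V S"
  \<comment> \<open>The threshold comes from the height estimates alone, so it can be fixed before
    \<epsilon>; only the exponent depends on \<epsilon>.\<close>
  proof (rule exI[of _ "exp A"], intro allI impI)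
    fix \<epsilon> :: real assume "0 < \<epsilon>"
    obtain \<phi> \<psi> where "\<phi> \<in> S" "\<psi> \<in> S" "\<phi> \<noteq> \<psi>"
      using free by (auto simp: free_nonabelian_def)
    then obtain s c c' where s: "0 < s" "0 < c" "0 < c'"
      "\<And>T. 0 \<le> T \<Longrightarrow> c * exp (s * T) \<le> real (card (words_upto T))"
      "\<And>T. real (card (words_upto T)) \<le> c' * exp ((s + \<epsilon>) * T)"
      using exp_two_sided_bound[OF _ _ _ \<open>0 < \<epsilon>\<close>] by metis
    \<comment> \<open>Freeness turns the count of maps into the count of words, with no multiplicity
      lost.\<close>
    have "inj_on (word_comp V) (low_words P B)" for P B
      using free by (auto simp: free_nonabelian_def low_words_def intro!: inj_onI)
    then have card: "card (word_comp V ` low_words P B) = card (low_words P B)" for P B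
      by (rule card_image)
    show "\<exists>b>0. \<forall>P\<in>V. exp (h P) > exp A \<longrightarrow>
          (\<forall>B. finite {f \<in> endo_monoid V S. exp (h (f P)) \<le> B}) \<and>
          (\<lambda>B. ln B powr b) \<lless> (\<lambda>B. real (card {f \<in> endo_monoid V S. exp (h (f P)) \<le> B})) \<and>
          (\<lambda>B. real (card {f \<in> endo_monoid V S. exp (h (f P)) \<le> B})) \<lless> (\<lambda>B. ln B powr (b + \<epsilon>))"
      unfolding endo_monoid_low card
    proof (intro exI[of _ s] conjI ballI impI allI)
      fix P assume "P \<in> V" "exp A < exp (h P)"
      then have P: "P \<in> V" "A < h P" by auto
      show "finite (word_comp V ` low_words P B)" for B
        by (intro finite_imageI finite_low_words P)
      show "(\<lambda>B. ln B powr s) \<lless> (\<lambda>B. real (card (low_words P B)))"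
        by (rule card_low_words_ge[OF P s(1,2,4)])
      show "(\<lambda>B. real (card (low_words P B))) \<lless> (\<lambda>B. ln B powr (s + \<epsilon>))"
        using s(1) \<open>0 < \<epsilon>\<close> by (intro card_low_words_le[OF P _ s(3,5)]) simp
    qed fact
  qed
  from part1 part2 show ?thesis by blast
qed

end
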